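(* Let $\psi$ be a local assertion on $B(0,r)$ with black index $b(\psi)>0$ and meaningful index $e(\psi)$. Let $p(n)=c\,n^{-\frac{2}{b(\psi)}}$, where $c$ is a positive constant (and $n$ is large enough that $p(n)\le 1$). Then $$\lim_{n\to\infty}\mu_{n,p(n)}(\widetilde{\psi}) = 1-\exp\left(-e(\psi)\,c^{b(\psi)}\right).$$
   Context: Random images. For a positive integer $n$, let $\Xi_n=\{1,\ldots,n\}^2$ be the pixel set, with periodic boundary conditions (i.e. identified with the torus $(\mathbb{Z}/n\mathbb{Z})^2$) and with the 4-connectivity graph structure (each pixel has 2 horizontal and 2 vertical neighbors). Let $d$ be the graph distance and $B(x,r)=\{y\in\Xi_n : d(x,y)\le r\}$. The radius $r$ is a fixed nonnegative integer and $n>2r+1$, so each ball $B(x,r)$ contains $2r^2+2r+1$ pixels, and all such balls are translates of one another. $B(0,r)$ denotes the reference ball, identified with $\{y\in\mathbb{Z}^2: |y_1|+|y_2|\le r\}$, and $\tau_x$ denotes the translation sending $B(0,r)$ to $B(x,r)$. A binary image of size $n$ is a colouring of $\Xi_n$ in black and white. $\mu_{n,p}$ is the probability distribution on binary images under which the colours of the pixels are independent, each pixel being black with probability $p$ and white with probability $1-p$. Patterns. A pattern $D$ is a black/white image on $B(0,r)$; $\beta(D)\subset B(0,r)$ is its set of black pixels and $b(D)=|\beta(D)|$. Let $\mathcal{D}$ be the (finite) set of all $2^{2r^2+2r+1}$ patterns. For $x\in\Xi_n$, $D(x)$ is the event that the restriction of the image to $B(x,r)$ is exactly the translated pattern $\tau_x(D)$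 (i.e. the black pixels in $B(x,r)$ are exactly those of $\tau_x(\beta(D))$). Local assertions. A local assertion $\psi$ on $B(0,r)$ is an assertion about the colours of the pixels in $B(0,r)$; it is identified with its definition set $\mathcal{D}(\psi)\subset\mathcal{D}$ (assumed nonempty), the set of patterns satisfying it: $\psi=\bigvee_{D\in\mathcal{D}(\psi)}D$. Its black index is $b(\psi)=\min_{D\in\mathcal{D}(\psi)}b(D)$. A meaningful definition set of $\psi$ is a subset $\mathcal{D}_0(\psi)\subset\mathcal{D}(\psi)$ such that: (a) $b(D)=b(\psi)$ for all $D\in\mathcal{D}_0(\psi)$; (b) if $\tau$ is a translation (of $\mathbb{Z}^2$), $D,D'\in\mathcal{D}_0(\psi)$ and $\tau(\beta(D))=\beta(D')$, then $D=D'$; (c) if $D\in\mathcal{D}(\psi)$ and $b(D)=b(\psi)$, then there exist a translation $\tau$ and $D'\in\mathcal{D}_0(\psi)$ such that $\tau(\beta(D))=\beta(D')$. All meaningful definition sets have the same cardinality, the meaningful index $e(\psi)$ of $\psi$. Local property. For $x\in\Xi_n$, $\psi(x)=\bigvee_{D\in\mathcal{D}(\psi)}D(x)$, and $\widetilde{\psi}$ is the event that there exists $x\in\Xi_n$ such that $\psi(x)$ holds. *)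

theory Defs
  imports "HOL-Probability.Product_PMF"
begin

type_synonym pixel = "int \<times> int"

text \<open>The two colours are coded by \<^typ>\<open>bool\<close>; \<^const>\<open>True\<close> is black.\<close>
type_synonym image = "pixel \<Rightarrow> bool"

definition pixels :: "nat \<Rightarrow> pixel set" where
  "pixels n = {1..int n} \<times> {1..int n}"

text \<open>The representative in \<^term>\<open>pixels n\<close> of a point of the plane lattice modulo \<open>n\<close>.\<close>
definition wrap :: "nat \<Rightarrow> int \<times> int \<Rightarrow> pixel" where
  "wrap n z = ((fst z - 1) mod int n + 1, (snd z - 1) mod int n + 1)"

definition torus_edges :: "nat \<Rightarrow> (pixel \<times> pixel) set" where
  "torus_edges n = {(x, y). x \<in> pixels n \<and>
     (\<exists>s \<in> {(1, 0), (-1, 0), (0, 1), (0, -1)}. y = wrap n (x + s))}"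

text \<open>Length of a shortest walk. The torus is connected, so the minimum is over a nonempty set
  whenever \<open>x\<close> and \<open>y\<close> are pixels.\<close>
definition graph_dist :: "nat \<Rightarrow> pixel \<Rightarrow> pixel \<Rightarrow> nat" where
  "graph_dist n x y = (LEAST k. (x, y) \<in> torus_edges n ^^ k)"

definition torus_ball :: "nat \<Rightarrow> pixel \<Rightarrow> nat \<Rightarrow> pixel set" where
  "torus_ball n x r = {y \<in> pixels n. graph_dist n x y \<le> r}"

definition ref_ball :: "nat \<Rightarrow> (int \<times> int) set" where
  "ref_ball r = {y. \<bar>fst y\<bar> + \<bar>snd y\<bar> \<le> int r}"

text \<open>For \<open>n > 2 * r + 1\<close> this is the translation carrying \<^term>\<open>ref_ball r\<close> bijectively onto
  \<^term>\<open>torus_ball n x r\<close>.\<close>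
definition shift :: "nat \<Rightarrow> pixel \<Rightarrow> int \<times> int \<Rightarrow> pixel" where
  "shift n x y = wrap n (x + y)"

text \<open>Images are made total by the dummy value \<^const>\<open>False\<close> outside \<^term>\<open>pixels n\<close>.
  The parameter of \<^const>\<open>bernoulli_pmf\<close> is clamped to the unit interval, so this is the intended
  measure only for \<open>0 \<le> p \<le> 1\<close>.\<close>
definition image_pmf :: "nat \<Rightarrow> real \<Rightarrow> image pmf" where
  "image_pmf n p = Pi_pmf (pixels n) False (\<lambda>_. bernoulli_pmf p)"

definition patterns :: "nat \<Rightarrow> (int \<times> int \<Rightarrow> bool) set" where
  "patterns r = ref_ball r \<rightarrow>\<^sub>E UNIV"

definition black :: "nat \<Rightarrow> (int \<times> int \<Rightarrow> bool) \<Rightarrow> (int \<times> int) set" where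
  "black r D = {y \<in> ref_ball r. D y}"

definition pattern_at :: "nat \<Rightarrow> nat \<Rightarrow> (int \<times> int \<Rightarrow> bool) \<Rightarrow> pixel \<Rightarrow> image set" where
  "pattern_at n r D x = {I. {y \<in> torus_ball n x r. I y} = shift n x ` black r D}"

text \<open>A local assertion is identified with its definition set, a nonempty set of patterns.\<close>
definition local_assertion :: "nat \<Rightarrow> (int \<times> int \<Rightarrow> bool) set \<Rightarrow> bool" where
  "local_assertion r \<psi> \<longleftrightarrow> \<psi> \<subseteq> patterns r \<and> \<psi> \<noteq> {}"

definition black_index :: "nat \<Rightarrow> (int \<times> int \<Rightarrow> bool) set \<Rightarrow> nat" where
  "black_index r \<psi> = Min ((\<lambda>D. card (black r D)) ` \<psi>)"

definition meaningful_set ::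
    "nat \<Rightarrow> (int \<times> int \<Rightarrow> bool) set \<Rightarrow> (int \<times> int \<Rightarrow> bool) set \<Rightarrow> bool" where
  "meaningful_set r \<psi> S \<longleftrightarrow> S \<subseteq> \<psi> \<and>
     (\<forall>D\<in>S. card (black r D) = black_index r \<psi>) \<and>
     (\<forall>D\<in>S. \<forall>D'\<in>S. \<forall>t. (+) t ` black r D = black r D' \<longrightarrow> D = D') \<and>
     (\<forall>D\<in>\<psi>. card (black r D) = black_index r \<psi> \<longrightarrow>
        (\<exists>t. \<exists>D'\<in>S. (+) t ` black r D = black r D'))"

text \<open>The common cardinality of all meaningful definition sets; see
  \<open>meaningful_index_eq\<close> and \<open>meaningful_set_exists\<close> below.\<close>
definition meaningful_index :: "nat \<Rightarrow> (int \<times> int \<Rightarrow> bool) set \<Rightarrow> nat" where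
  "meaningful_index r \<psi> = (THE k. \<exists>S. meaningful_set r \<psi> S \<and> card S = k)"

definition assertion_at :: "nat \<Rightarrow> nat \<Rightarrow> (int \<times> int \<Rightarrow> bool) set \<Rightarrow> pixel \<Rightarrow> image set" where
  "assertion_at n r \<psi> x = (\<Union>D\<in>\<psi>. pattern_at n r D x)"

definition local_property :: "nat \<Rightarrow> nat \<Rightarrow> (int \<times> int \<Rightarrow> bool) set \<Rightarrow> image set" where
  "local_property n r \<psi> = (\<Union>x\<in>pixels n. assertion_at n r \<psi> x)"

lemma translate_back:
  fixes A B :: "(int \<times> int) set"
  assumes "(+) t ` A = B"
  shows "(+) (- t) ` B = A"
  unfolding assms[symmetric] by (simp add: image_image)

lemma translate_trans:
  fixes A B C :: "(int \<times> int) set"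
  assumes "(+) t ` A = B" "(+) s ` B = C"
  shows "(+) (s + t) ` A = C"
  unfolding assms(1)[symmetric] assms(2)[symmetric] by (simp add: image_image add.assoc)

lemma finite_ref_ball: "finite (ref_ball r)"
proof (rule finite_subset)
  show "ref_ball r \<subseteq> {- int r..int r} \<times> {- int r..int r}"
    by (auto simp: ref_ball_def)
qed auto

lemma finite_patterns: "finite (patterns r)"
  unfolding patterns_def by (intro finite_PiE finite_ref_ball) auto

lemma meaningful_set_card_le:
  assumes "local_assertion r \<psi>" "meaningful_set r \<psi> S" "meaningful_set r \<psi> T"
  shows "card S \<le> card T"
proof -
  have S: "D \<in> \<psi>" "card (black r D) = black_index r \<psi>" if "D \<in> S" for D
    using assms(2) that unfolding meaningful_set_def by auto
  have inj: "D = E" if "D \<in> S" "E \<in> S" "(+) t ` black r D = black r E" for D E t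
    using assms(2) that unfolding meaningful_set_def by metis
  have "\<exists>D'. D' \<in> T \<and> (\<exists>t. (+) t ` black r D = black r D')"
    if "D \<in> \<psi>" "card (black r D) = black_index r \<psi>" for D
    using assms(3) that unfolding meaningful_set_def by metis
  then have "\<forall>D\<in>S. \<exists>D'. D' \<in> T \<and> (\<exists>t. (+) t ` black r D = black r D')"
    using S by simp
  from bchoice[OF this] obtain f
    where f: "\<forall>D\<in>S. f D \<in> T \<and> (\<exists>t. (+) t ` black r D = black r (f D))" ..
  have "inj_on f S"
  proof (rule inj_onI)
    fix D E assume DE: "D \<in> S" "E \<in> S" "f D = f E"
    obtain t where t: "(+) t ` black r D = black r (f D)"
      using f DE(1) by blast
    obtain s where s: "(+) s ` black r E = black r (f D)"
      unfolding DE(3) using f DE(2) by blast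
    show "D = E"
      by (rule inj[OF DE(1,2) translate_trans[OF t translate_back[OF s]]])
  qed
  moreover have "f ` S \<subseteq> T"
    using f by blast
  moreover have "T \<subseteq> patterns r"
    using assms(1,3) unfolding local_assertion_def meaningful_set_def by (meson subset_trans)
  then have "finite T"
    by (rule finite_subset[OF _ finite_patterns])
  ultimately show ?thesis
    by (rule card_inj_on_le)
qed

lemma meaningful_index_eq:
  assumes "local_assertion r \<psi>" "meaningful_set r \<psi> S"
  shows "meaningful_index r \<psi> = card S"
  unfolding meaningful_index_def
proof (rule the_equality)
  show "\<exists>T. meaningful_set r \<psi> T \<and> card T = card S"
    using assms(2) by blast
  show "k = card S" if k: "\<exists>T. meaningful_set r \<psi> T \<and> card T = k" for k
  proof -
    obtain T where "meaningful_set r \<psi> T" "card T = k"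
      using k by blast
    then show ?thesis
      using meaningful_set_card_le[OF assms(1)] assms(2) by (auto intro: le_antisym)
  qed
qed

lemma meaningful_set_exists:
  "\<exists>S. meaningful_set r \<psi> S"
proof -
  define M where "M = {D \<in> \<psi>. card (black r D) = black_index r \<psi>}"
  define g where "g D = (SOME E. E \<in> M \<and> (\<exists>t. (+) t ` black r D = black r E))" for D
  have g: "g D \<in> M \<and> (\<exists>t. (+) t ` black r D = black r (g D))" if "D \<in> M" for D
    unfolding g_def
  proof (rule someI[where x = D])
    have "(+) 0 ` black r D = black r D" by simp
    then show "D \<in> M \<and> (\<exists>t. (+) t ` black r D = black r D)"
      using that by blast
  qed
  have g_cong: "g D = g E" if t: "(+) t ` black r D = black r E" for D E t
  proof -
    have "(\<exists>u. (+) u ` black r D = black r F) \<longleftrightarrow> (\<exists>u. (+) u ` black r E = black r F)" for F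
      by (rule iffI; elim exE; rule exI)
        (erule translate_trans[OF translate_back[OF t]] translate_trans[OF t])+
    then show ?thesis unfolding g_def by simp
  qed
  have "meaningful_set r \<psi> (g ` M)"
    unfolding meaningful_set_def
  proof (intro conjI ballI allI impI)
    show "g ` M \<subseteq> \<psi>" using g M_def by blast
    show "card (black r D) = black_index r \<psi>" if "D \<in> g ` M" for D
      using that g M_def by blast
    show "D = D'" if D: "D \<in> g ` M" "D' \<in> g ` M" "(+) t ` black r D = black r D'" for D D' t
    proof -
      have fixed: "g E = E" if "E \<in> g ` M" for E
      proof -
        obtain F where F: "F \<in> M" "E = g F" using \<open>E \<in> g ` M\<close> by blast
        obtain u where "(+) u ` black r F = black r E" using g[OF F(1)] F(2) by blast
        from g_cong[OF this] F(2) show ?thesis by simp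
      qed
      show ?thesis using g_cong[OF D(3)] fixed[OF D(1)] fixed[OF D(2)] by simp
    qed
    show "\<exists>t. \<exists>D'\<in>g ` M. (+) t ` black r D = black r D'"
      if "D \<in> \<psi>" "card (black r D) = black_index r \<psi>" for D
      using g[of D] that unfolding M_def by blast
  qed
  then show ?thesis ..
qed

end

theory Submission
  imports Defs
begin

text \<open>
  Write \<open>b\<close> and \<open>e\<close> for the black and the meaningful index and fix a meaningful set \<open>S\<close>. At the
  scale \<open>p = c n powr (-2/b)\<close> one has \<open>n\<^sup>2 p\<^sup>b = c\<^sup>b\<close>, whereas balls with \<open>b + 1\<close> black pixels are so rare
  that with probability \<open>1 - O(n\<^sup>2 p ^ (b+1))\<close> there are none. In the absence of such crowded balls, the
  local property holds iff all pixels of some \<open>shift n x ` black r D\<close> with \<open>D \<in> S\<close> are black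
  (lemmas \<open>local_property_subset\<close> and \<open>occurrence_subset_local_property\<close>): a ball without a further
  black pixel shows the pattern exactly, and a pattern of \<open>\<psi>\<close> with \<open>b\<close> black pixels is a translate of
  one in \<open>S\<close>.

  These are \<open>e n\<^sup>2\<close> events of probability \<open>p\<^sup>b\<close>, and for large \<open>n\<close> they come from \<open>e n\<^sup>2\<close> different
  sets of pixels (\<open>inj_on_occurrence\<close>). If they were independent, the probability that none of
  them occurs would be \<open>(1 - p\<^sup>b) ^ (n\<^sup>2 e) = (1 - c\<^sup>b / n\<^sup>2) ^ (n\<^sup>2 e)\<close>, which tends to \<open>exp (- e c\<^sup>b)\<close>.

  Independence fails only between events whose pixel sets meet. The lemma
  \<open>prob_union_local_dependence\<close> bounds the effect by the sum of \<open>P(A\<^sub>i \<inter> A\<^sub>j) + P(A\<^sub>i) P(A\<^sub>j)\<close> over the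
  dependent pairs, the same quantity as in the Chen--Stein method, but obtained by adding the events
  one at a time. Every event has a bounded number of dependent partners
  (\<open>card_occurrences_meeting\<close>), and two different sets of \<open>b\<close> pixels have at least \<open>b + 1\<close> pixels
  together, so the sum is again \<open>O(n\<^sup>2 p ^ (b+1)) = O(p)\<close>.
\<close>

section \<open>Poisson approximation for locally dependent events\<close>

text \<open>Adding one event \<open>A i\<close> to a union \<open>U\<close> multiplies the probability of the complement by
  \<open>1 - prob (A i)\<close>, up to the correlation between \<open>A i\<close> and \<open>U\<close>. Only the part of \<open>U\<close> coming from
  the events on which \<open>A i\<close> depends is correlated with \<open>A i\<close>, and replacing \<open>U\<close> by its independent
  part costs at most the first half of the right-hand side in \<open>prob (A i \<inter> U)\<close> and at most the second
  half in \<open>prob (A i) * prob U\<close>.\<close>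

lemma (in prob_space) correlation_with_union:
  assumes "finite J" and A: "\<And>j. j \<in> insert i J \<Longrightarrow> A j \<in> events"
    and ind: "\<And>K. K \<subseteq> J \<Longrightarrow> (\<And>j. j \<in> K \<Longrightarrow> \<not> dep i j) \<Longrightarrow>
       prob (A i \<inter> \<Union>(A ` K)) = prob (A i) * prob (\<Union>(A ` K))"
  shows "\<bar>prob (A i \<inter> \<Union>(A ` J)) - prob (A i) * prob (\<Union>(A ` J))\<bar>
    \<le> (\<Sum>j\<in>{j\<in>J. dep i j}. prob (A i \<inter> A j) + prob (A i) * prob (A j))"
proof -
  define N where "N = {j\<in>J. dep i j}"
  define U where "U = \<Union>(A ` J)"
  define V where "V = \<Union>(A ` (J - N))"
  have [simp]: "finite N" using assms(1) by (simp add: N_def)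
  have NJ: "N \<subseteq> J" by (auto simp: N_def)
  have meas [measurable]: "A i \<in> events" "U \<in> events" "V \<in> events"
    using A assms(1) by (auto simp: U_def V_def intro!: sets.finite_UN)
  have UV: "U = V \<union> \<Union>(A ` N)" using NJ by (auto simp: U_def V_def)
  have indV: "prob (A i \<inter> V) = prob (A i) * prob V"
    unfolding V_def by (rule ind) (auto simp: N_def)
  have subN: "prob (\<Union>(B ` N)) \<le> (\<Sum>j\<in>N. prob (B j))" if "B ` N \<subseteq> events" for B :: "_ \<Rightarrow> 'a set"
    using that by (intro finite_measure_subadditive_finite) auto
  have AN: "A ` N \<subseteq> events" using A NJ by auto
  have AiN: "(\<lambda>j. A i \<inter> A j) ` N \<subseteq> events" using A NJ by (auto intro!: sets.Int)
  have "V \<subseteq> U" unfolding UV by blast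
  then have lo1: "prob V \<le> prob U" and lo2: "prob (A i \<inter> V) \<le> prob (A i \<inter> U)"
    using \<open>V \<subseteq> U\<close> by (auto intro!: finite_measure_mono sets.Int meas)
  have "prob U \<le> prob V + prob (\<Union>(A ` N))"
    unfolding UV using AN by (intro measure_Un_le meas sets.finite_UN) auto
  then have hi1: "prob U \<le> prob V + (\<Sum>j\<in>N. prob (A j))"
    using subN[OF AN] by linarith
  have "A i \<inter> U = (A i \<inter> V) \<union> (\<Union>j\<in>N. A i \<inter> A j)" unfolding UV by auto
  then have "prob (A i \<inter> U) \<le> prob (A i \<inter> V) + prob (\<Union>j\<in>N. A i \<inter> A j)"
    using AN by (simp only:) (intro measure_Un_le sets.Int meas sets.finite_UN, auto)
  then have hi2: "prob (A i \<inter> U) \<le> prob (A i \<inter> V) + (\<Sum>j\<in>N. prob (A i \<inter> A j))"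
    using subN[OF AiN] by linarith
  have hi1': "prob (A i) * prob U \<le> prob (A i) * prob V + (\<Sum>j\<in>N. prob (A i) * prob (A j))"
    using mult_left_mono[OF hi1, of "prob (A i)"] by (simp add: distrib_left sum_distrib_left)
  have lo1': "prob (A i) * prob V \<le> prob (A i) * prob U"
    by (intro mult_left_mono lo1) auto
  have "0 \<le> (\<Sum>j\<in>N. prob (A i \<inter> A j))" "0 \<le> (\<Sum>j\<in>N. prob (A i) * prob (A j))"
    by (intro sum_nonneg; simp)+
  then show ?thesis
    using hi1' hi2 lo1' lo2 indV unfolding N_def[symmetric] U_def[symmetric] sum.distrib by linarith
qed

text \<open>The recursion \<open>P(none of I + i) = (1 - P(A i)) P(none of I) + error\<close> contracts, so the errors
  of the successive steps just add up.\<close>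

lemma (in prob_space) prob_union_local_dependence:
  assumes "finite I" and A: "\<And>i. i \<in> I \<Longrightarrow> A i \<in> events"
    and ind: "\<And>i K. i \<in> I \<Longrightarrow> K \<subseteq> I \<Longrightarrow> (\<And>j. j \<in> K \<Longrightarrow> \<not> dep i j) \<Longrightarrow>
       prob (A i \<inter> \<Union>(A ` K)) = prob (A i) * prob (\<Union>(A ` K))"
  shows "\<bar>prob (\<Union>(A ` I)) - (1 - (\<Prod>i\<in>I. 1 - prob (A i)))\<bar>
    \<le> (\<Sum>i\<in>I. \<Sum>j\<in>{j\<in>I. j \<noteq> i \<and> dep i j}. prob (A i \<inter> A j) + prob (A i) * prob (A j))"
  using assms
proof (induction I rule: finite_induct)
  case empty
  then show ?case by simp
next
  case (insert i J)
  define g where "g i j = prob (A i \<inter> A j) + prob (A i) * prob (A j)" for i j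
  define U where "U = \<Union>(A ` J)"
  define q where "q = (\<Prod>i\<in>J. 1 - prob (A i))"
  define R where "R = (\<Sum>i\<in>J. \<Sum>j\<in>{j\<in>J. j \<noteq> i \<and> dep i j}. g i j)"
  define Q where "Q = (\<Sum>j\<in>{j\<in>J. dep i j}. g i j)"
  have g0: "g i j \<ge> 0" for i j by (simp add: g_def)
  have IH: "\<bar>prob U - (1 - q)\<bar> \<le> R"
    unfolding U_def q_def R_def g_def
    using insert.prems by (intro insert.IH) (auto simp: subset_insertI2)
  have corr: "\<bar>prob (A i \<inter> U) - prob (A i) * prob U\<bar> \<le> Q"
    unfolding U_def Q_def g_def
    using insert.prems insert.hyps by (intro correlation_with_union) (auto simp: subset_insertI2)
  have Ai: "A i \<in> events" and U: "U \<in> events"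
    using insert.prems insert.hyps by (auto simp: U_def)
  have un: "prob (\<Union>(A ` insert i J)) = prob (A i) + prob U - prob (A i \<inter> U)"
    using measure_Un3[of "A i" M U] Ai U by (simp add: U_def fmeasurable_eq_sets)
  have pr: "(\<Prod>k\<in>insert i J. 1 - prob (A k)) = (1 - prob (A i)) * q"
    using insert.hyps by (simp add: q_def)
  have "R + Q \<le> (\<Sum>k\<in>insert i J. \<Sum>j\<in>{j\<in>insert i J. j \<noteq> k \<and> dep k j}. g k j)"
  proof -
    have "R \<le> (\<Sum>k\<in>J. \<Sum>j\<in>{j\<in>insert i J. j \<noteq> k \<and> dep k j}. g k j)"
      unfolding R_def using insert.hyps g0 by (intro sum_mono sum_mono2) auto
    moreover have "{j\<in>insert i J. j \<noteq> i \<and> dep i j} = {j\<in>J. dep i j}"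
      using insert.hyps by auto
    ultimately show ?thesis
      using insert.hyps by (simp add: Q_def)
  qed
  moreover have "\<bar>prob (\<Union>(A ` insert i J)) - (1 - (\<Prod>k\<in>insert i J. 1 - prob (A k)))\<bar> \<le> R + Q"
  proof -
    have "prob (\<Union>(A ` insert i J)) - (1 - (\<Prod>k\<in>insert i J. 1 - prob (A k)))
      = (1 - prob (A i)) * (prob U - (1 - q)) - (prob (A i \<inter> U) - prob (A i) * prob U)"
      unfolding un pr by (simp add: algebra_simps)
    moreover have "\<bar>(1 - prob (A i)) * (prob U - (1 - q))\<bar> \<le> 1 * \<bar>prob U - (1 - q)\<bar>"
      unfolding abs_mult by (intro mult_right_mono) (auto simp: abs_le_iff)
    then have "\<bar>(1 - prob (A i)) * (prob U - (1 - q))\<bar> \<le> R" using IH by simp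
    ultimately show ?thesis
      using order_trans[OF abs_triangle_ineq4 add_mono[OF _ corr]] by simp
  qed
  ultimately show ?case unfolding g_def by linarith
qed

section \<open>Independence in a random image\<close>

lemma prob_pair_pmf_Times:
  "measure_pmf.prob (pair_pmf M N) (A \<times> B) = measure_pmf.prob M A * measure_pmf.prob N B"
proof -
  have "measure_pmf.prob (pair_pmf M N) (A \<times> B)
      = measure_pmf.prob (pair_pmf M N) ((A \<inter> set_pmf M) \<times> (B \<inter> set_pmf N))"
    using measure_Int_set_pmf[of "pair_pmf M N" "A \<times> B"] by (simp add: Times_Int_Times)
  also have "\<dots> = measure_pmf.prob M (A \<inter> set_pmf M) * measure_pmf.prob N (B \<inter> set_pmf N)"
    by (intro measure_pmf_prob_product) auto
  finally show ?thesis by (simp add: measure_Int_set_pmf)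
qed

lemma Pi_pmf_indep_disjoint_coordinates:
  assumes "finite A" "F \<subseteq> A"
    and X: "\<And>f g. (\<And>x. x \<in> F \<Longrightarrow> f x = g x) \<Longrightarrow> f \<in> X \<longleftrightarrow> g \<in> X"
    and Y: "\<And>f g. (\<And>x. x \<notin> F \<Longrightarrow> f x = g x) \<Longrightarrow> f \<in> Y \<longleftrightarrow> g \<in> Y"
  shows "measure_pmf.prob (Pi_pmf A d p) (X \<inter> Y)
    = measure_pmf.prob (Pi_pmf A d p) X * measure_pmf.prob (Pi_pmf A d p) Y"
proof -
  define h where "h = (\<lambda>(f :: 'a \<Rightarrow> 'b, g) x. if x \<in> F then f x else g x)"
  define P where "P = Pi_pmf F d p"
  define Q where "Q = Pi_pmf (A - F) d p"
  have "Pi_pmf (F \<union> (A - F)) d p = map_pmf h (pair_pmf P Q)"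
    unfolding h_def P_def Q_def using assms by (intro Pi_pmf_union) (auto dest: finite_subset)
  then have PQ: "Pi_pmf A d p = map_pmf h (pair_pmf P Q)"
    using assms(2) by (simp add: Un_absorb1)
  have hX: "h (f, g) \<in> X \<longleftrightarrow> f \<in> X" for f g by (rule X) (simp add: h_def)
  have hY: "h (f, g) \<in> Y \<longleftrightarrow> g \<in> Y" for f g by (rule Y) (simp add: h_def)
  have "h -` (X \<inter> Y) = X \<times> Y" "h -` X = X \<times> UNIV" "h -` Y = UNIV \<times> Y"
    using hX hY by auto
  then show ?thesis
    unfolding PQ by (simp add: prob_pair_pmf_Times)
qed

definition all_black :: "pixel set \<Rightarrow> image set" where
  "all_black F = {I. \<forall>z\<in>F. I z}"

lemma all_black_Int: "all_black F \<inter> all_black G = all_black (F \<union> G)"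
  by (auto simp: all_black_def)

lemma finite_pixels [simp]: "finite (pixels n)"
  by (simp add: pixels_def)

lemma card_pixels: "card (pixels n) = n\<^sup>2"
  by (simp add: pixels_def card_cartesian_product power2_eq_square)

lemma prob_all_black:
  assumes "F \<subseteq> pixels n" "0 \<le> p" "p \<le> 1"
  shows "measure_pmf.prob (image_pmf n p) (all_black F) = p ^ card F"
proof -
  define B where "B z = (if z \<in> F then {True} else UNIV)" for z
  have "all_black F = Pi (pixels n) B"
    using assms(1) by (auto simp: all_black_def B_def Pi_def split: if_splits)
  then have "measure_pmf.prob (image_pmf n p) (all_black F)
      = (\<Prod>z\<in>pixels n. measure_pmf.prob (bernoulli_pmf p) (B z))"
    by (simp add: image_pmf_def measure_Pi_pmf_Pi)
  also have "\<dots> = (\<Prod>z\<in>pixels n. if z \<in> F then p else 1)"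
    using assms by (intro prod.cong) (auto simp: B_def measure_pmf_single)
  also have "\<dots> = (\<Prod>z\<in>F. p)"
    using assms(1) by (simp add: prod.If_cases Int_absorb1)
  finally show ?thesis by simp
qed

lemma all_black_indep_union:
  assumes "F \<subseteq> pixels n" "\<And>k. k \<in> K \<Longrightarrow> F \<inter> G k = {}"
  shows "measure_pmf.prob (image_pmf n p) (all_black F \<inter> (\<Union>k\<in>K. all_black (G k)))
    = measure_pmf.prob (image_pmf n p) (all_black F)
      * measure_pmf.prob (image_pmf n p) (\<Union>k\<in>K. all_black (G k))"
  unfolding image_pmf_def
proof (rule Pi_pmf_indep_disjoint_coordinates[OF finite_pixels assms(1)])
  fix f g :: image
  assume "\<And>x. x \<in> F \<Longrightarrow> f x = g x"
  then show "f \<in> all_black F \<longleftrightarrow> g \<in> all_black F" by (auto simp: all_black_def)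
next
  fix f g :: image
  assume fg: "\<And>x. x \<notin> F \<Longrightarrow> f x = g x"
  have "f z = g z" if "k \<in> K" "z \<in> G k" for k z
    using assms(2)[OF that(1)] that(2) by (intro fg) auto
  then show "f \<in> (\<Union>k\<in>K. all_black (G k)) \<longleftrightarrow> g \<in> (\<Union>k\<in>K. all_black (G k))"
    by (auto simp: all_black_def)
qed

section \<open>Geometry of the torus\<close>

lemma wrap_eq_iff:
  "wrap n z = wrap n w \<longleftrightarrow> int n dvd fst z - fst w \<and> int n dvd snd z - snd w"
  by (simp add: wrap_def mod_eq_dvd_iff)

lemma wrap_in_pixels: "n > 0 \<Longrightarrow> wrap n z \<in> pixels n"
  by (simp add: wrap_def pixels_def add1_zle_eq)

lemma wrap_pixel: "x \<in> pixels n \<Longrightarrow> wrap n x = x"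
  by (auto simp: wrap_def pixels_def)

lemma wrap_wrap_add: "wrap n (wrap n z + w) = wrap n (z + w)"
proof -
  have "wrap n (wrap n z) = wrap n z" by (simp add: wrap_def)
  then have "int n dvd fst (wrap n z) - fst z" "int n dvd snd (wrap n z) - snd z"
    by (simp_all add: wrap_eq_iff)
  then show ?thesis by (simp add: wrap_eq_iff)
qed

lemma shift_in_pixels: "n > 0 \<Longrightarrow> shift n x y \<in> pixels n"
  by (simp add: shift_def wrap_in_pixels)

lemma black_subset: "black r D \<subseteq> ref_ball r"
  by (auto simp: black_def)

text \<open>The walk is built from its end: the last step \<open>s\<close> brings \<open>y\<close> one step closer to the origin,
  horizontally as long as possible. Besides bounding distances, this shows that the torus is
  connected, without which the minimum in \<open>graph_dist\<close> would carry no information.\<close>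

lemma walk_to_wrap:
  assumes "x \<in> pixels n"
  shows "\<bar>fst y\<bar> + \<bar>snd y\<bar> = int k \<Longrightarrow> (x, wrap n (x + y)) \<in> torus_edges n ^^ k"
proof (induction k arbitrary: y)
  case 0
  then have "y = 0" by (auto simp: prod_eq_iff)
  then show ?case using wrap_pixel[OF assms] by simp
next
  case (Suc k)
  have n: "n > 0" using assms by (cases n) (auto simp: pixels_def)
  define s :: "int \<times> int" where
    "s = (if fst y \<noteq> 0 then (sgn (fst y), 0) else (0, sgn (snd y)))"
  have s: "s \<in> {(1, 0), (-1, 0), (0, 1), (0, -1)}"
    using Suc.prems by (auto simp: s_def sgn_if)
  have "\<bar>fst (y - s)\<bar> + \<bar>snd (y - s)\<bar> = int k"
    using Suc.prems by (auto simp: s_def sgn_if split: if_splits)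
  then have "(x, wrap n (x + (y - s))) \<in> torus_edges n ^^ k" by (rule Suc.IH)
  moreover have "wrap n (x + y) = wrap n (wrap n (x + (y - s)) + s)"
    unfolding wrap_wrap_add by simp
  then have "(wrap n (x + (y - s)), wrap n (x + y)) \<in> torus_edges n"
    using s wrap_in_pixels[OF n] unfolding torus_edges_def by blast
  ultimately show ?case by (rule relpow_Suc_I)
qed

lemma walk_from_wrap:
  assumes "x \<in> pixels n"
  shows "(x, z) \<in> torus_edges n ^^ k \<Longrightarrow> \<exists>y. \<bar>fst y\<bar> + \<bar>snd y\<bar> \<le> int k \<and> z = wrap n (x + y)"
proof (induction k arbitrary: z)
  case 0
  then show ?case using wrap_pixel[OF assms] by (intro exI[of _ 0]) simp
next
  case (Suc k)
  then obtain w where w: "(x, w) \<in> torus_edges n ^^ k" "(w, z) \<in> torus_edges n"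
    by (auto elim: relpow_Suc_E)
  obtain y where y: "\<bar>fst y\<bar> + \<bar>snd y\<bar> \<le> int k" "w = wrap n (x + y)"
    using Suc.IH[OF w(1)] by blast
  obtain s where s: "s \<in> {(1, 0), (-1, 0), (0, 1), (0, -1)}" "z = wrap n (w + s)"
    using w(2) by (auto simp: torus_edges_def)
  have "z = wrap n (x + (y + s))"
    unfolding s(2) y(2) wrap_wrap_add by (simp add: add.assoc)
  moreover have "\<bar>fst (y + s)\<bar> + \<bar>snd (y + s)\<bar> \<le> int (Suc k)"
    using s(1) y(1) by auto
  ultimately show ?case by blast
qed

lemma torus_ball_eq_shift:
  assumes "x \<in> pixels n"
  shows "torus_ball n x r = shift n x ` ref_ball r"
proof (intro equalityI subsetI)
  have n: "n > 0" using assms by (cases n) (auto simp: pixels_def)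
  fix z
  {
    assume "z \<in> torus_ball n x r"
    then have z: "z \<in> pixels n" "graph_dist n x z \<le> r" by (auto simp: torus_ball_def)
    have "(x, wrap n (x + (z - x))) \<in> torus_edges n ^^ nat (\<bar>fst (z - x)\<bar> + \<bar>snd (z - x)\<bar>)"
      by (rule walk_to_wrap[OF assms]) simp
    then have "(x, z) \<in> torus_edges n ^^ nat (\<bar>fst (z - x)\<bar> + \<bar>snd (z - x)\<bar>)"
      using wrap_pixel[OF z(1)] by simp
    then have "(x, z) \<in> torus_edges n ^^ graph_dist n x z"
      unfolding graph_dist_def by (rule LeastI)
    from walk_from_wrap[OF assms this] obtain y
      where "\<bar>fst y\<bar> + \<bar>snd y\<bar> \<le> int (graph_dist n x z)" "z = wrap n (x + y)" by blast
    then show "z \<in> shift n x ` ref_ball r"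
      using z(2) by (intro image_eqI[of _ _ y]) (auto simp: shift_def ref_ball_def)
  next
    assume "z \<in> shift n x ` ref_ball r"
    then obtain y where y: "\<bar>fst y\<bar> + \<bar>snd y\<bar> \<le> int r" "z = wrap n (x + y)"
      by (auto simp: shift_def ref_ball_def)
    have "graph_dist n x z \<le> nat (\<bar>fst y\<bar> + \<bar>snd y\<bar>)"
      unfolding graph_dist_def y(2) by (intro Least_le walk_to_wrap[OF assms]) simp
    then show "z \<in> torus_ball n x r"
      using y n by (auto simp: torus_ball_def wrap_in_pixels)
  }
qed

text \<open>On a torus of side larger than \<open>4 r\<close>, differences of two points of the reference ball are
  determined by their residues, so translations between wrapped balls lift to the plane.\<close>

lemma shift_eq_lifts:
  assumes "n > 4 * r" "{y, y', w, w'} \<subseteq> ref_ball r"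
    and "shift n x y = shift n x' y'" "shift n x w = shift n x' w'"
  shows "y' - y = w' - w"
proof -
  have small: "a = 0" if "int n dvd a" "\<bar>a\<bar> \<le> 4 * int r" for a
    using that assms(1) dvd_imp_le_int[of a "int n"] by fastforce
  have d: "int n dvd fst (x + y) - fst (x' + y')" "int n dvd fst (x + w) - fst (x' + w')"
    "int n dvd snd (x + y) - snd (x' + y')" "int n dvd snd (x + w) - snd (x' + w')"
    using assms(3,4) by (auto simp: shift_def wrap_eq_iff)
  have b: "\<bar>fst v\<bar> \<le> int r" "\<bar>snd v\<bar> \<le> int r" if "v \<in> ref_ball r" for v
    using that by (auto simp: ref_ball_def)
  have mem: "y \<in> ref_ball r" "y' \<in> ref_ball r" "w \<in> ref_ball r" "w' \<in> ref_ball r"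
    using assms(2) by auto
  have "fst w' - fst w - (fst y' - fst y) = 0"
  proof (rule small)
    show "int n dvd fst w' - fst w - (fst y' - fst y)"
      using dvd_diff[OF d(1,2)] by (simp add: algebra_simps)
    show "\<bar>fst w' - fst w - (fst y' - fst y)\<bar> \<le> 4 * int r"
      using mem[THEN b(1)] unfolding abs_le_iff by linarith
  qed
  moreover have "snd w' - snd w - (snd y' - snd y) = 0"
  proof (rule small)
    show "int n dvd snd w' - snd w - (snd y' - snd y)"
      using dvd_diff[OF d(3,4)] by (simp add: algebra_simps)
    show "\<bar>snd w' - snd w - (snd y' - snd y)\<bar> \<le> 4 * int r"
      using mem[THEN b(2)] unfolding abs_le_iff by linarith
  qed
  ultimately show ?thesis by (simp add: prod_eq_iff)
qed

lemma inj_on_shift: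
  assumes "n > 4 * r"
  shows "inj_on (shift n x) (ref_ball r)"
proof (rule inj_onI)
  fix y y' assume "y \<in> ref_ball r" "y' \<in> ref_ball r" "shift n x y = shift n x y'"
  with shift_eq_lifts[OF assms, of y y' y y x x] show "y = y'" by simp
qed

lemma card_shift:
  assumes "n > 4 * r" "B \<subseteq> ref_ball r"
  shows "card (shift n x ` B) = card B"
  by (intro card_image inj_on_subset[OF inj_on_shift[OF assms(1)] assms(2)])

text \<open>Comparing the coordinate sums of the two sides.\<close>

lemma finite_set_not_translation_invariant:
  fixes B :: "(int \<times> int) set"
  assumes "finite B" "B \<noteq> {}" "(+) t ` B = B"
  shows "t = 0"
proof -
  have "(\<Sum>y\<in>B. f y) = (\<Sum>y\<in>B. f (t + y))" for f :: "_ \<Rightarrow> int"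
    using sum.reindex[of "(+) t" B f] assms(3) by simp
  from this[of fst] this[of snd] have "int (card B) * fst t = 0" "int (card B) * snd t = 0"
    by (simp_all add: sum.distrib)
  then show ?thesis using assms by (auto simp: prod_eq_iff)
qed

lemma shift_image_eq_lifts:
  assumes n: "n > 4 * r" and B: "B \<subseteq> ref_ball r" "B' \<subseteq> ref_ball r" "B \<noteq> {}"
    and eq: "shift n x ` B = shift n x' ` B'"
  obtains t where "(+) t ` B = B'" "wrap n x = wrap n (x' + t)"
proof -
  obtain w where w: "w \<in> B" using B(3) by blast
  from imageI[OF w, of "shift n x"] obtain w' where w': "w' \<in> B'" "shift n x w = shift n x' w'"
    unfolding eq by (elim imageE)
  define t where "t = w' - w"
  have "t + y \<in> B'" if "y \<in> B" for y
  proof -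
    from imageI[OF that, of "shift n x"] obtain y' where y': "y' \<in> B'" "shift n x y = shift n x' y'"
      unfolding eq by (elim imageE)
    have "y' - y = t"
      unfolding t_def by (rule shift_eq_lifts[OF n _ y'(2) w'(2)]) (use B that w w' y' in auto)
    then show ?thesis using y'(1) by (simp add: algebra_simps)
  qed
  then have "(+) t ` B \<subseteq> B'" by blast
  moreover have "card ((+) t ` B) = card B'"
    using card_shift[OF n B(1), of x] card_shift[OF n B(2), of x'] eq by (simp add: card_image)
  moreover have "finite B'" using B(2) finite_ref_ball finite_subset by blast
  ultimately have "(+) t ` B = B'" by (intro card_subset_eq)
  moreover have "wrap n x = wrap n (x' + t)"
    using w'(2) by (simp add: shift_def wrap_eq_iff t_def algebra_simps)
  ultimately show ?thesis by (rule that)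
qed

section \<open>Occurrences of the minimal patterns\<close>

definition occurrence :: "nat \<Rightarrow> nat \<Rightarrow> pixel \<times> (int \<times> int \<Rightarrow> bool) \<Rightarrow> pixel set" where
  "occurrence n r = (\<lambda>(x, D). shift n x ` black r D)"

text \<open>Two equal occurrences lift to a translation between black sets of patterns in \<open>S\<close>, and different
  patterns in \<open>S\<close> are not translates of each other. So the patterns agree, and then so do the centres,
  as a nonempty finite set is not invariant under a nonzero translation.\<close>

lemma inj_on_occurrence:
  assumes S: "meaningful_set r \<psi> S" and b: "black_index r \<psi> > 0" and n: "n > 4 * r"
  shows "inj_on (occurrence n r) (pixels n \<times> S)"
proof (rule inj_onI, clarify)
  fix x D x' D'
  assume x: "x \<in> pixels n" "x' \<in> pixels n" and D: "D \<in> S" "D' \<in> S"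
    and "occurrence n r (x, D) = occurrence n r (x', D')"
  then have eq: "shift n x ` black r D = shift n x' ` black r D'"
    by (simp add: occurrence_def)
  have "card (black r D) > 0" using S D b unfolding meaningful_set_def by auto
  then have ne: "black r D \<noteq> {}" "finite (black r D)" using card_gt_0_iff by blast+
  obtain t where t: "(+) t ` black r D = black r D'" "wrap n x = wrap n (x' + t)"
    by (rule shift_image_eq_lifts[OF n black_subset black_subset ne(1) eq])
  have "D = D'" using S D t(1) unfolding meaningful_set_def by blast
  with t(1) finite_set_not_translation_invariant[OF ne(2,1)] have "t = 0" by simp
  with t(2) x wrap_pixel have "x = x'" by simp
  with \<open>D = D'\<close> show "x = x' \<and> D = D'" by simp
qed

text \<open>If the two occurrences share a pixel, coming from \<open>y\<close> and \<open>y'\<close> in the reference ball, then the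
  second centre is the first one moved by \<open>y - y'\<close>. Hence \<open>y\<close>, \<open>y'\<close> and the second pattern
  determine \<open>j\<close>, which gives a bound that does not involve \<open>n\<close>.\<close>

lemma card_occurrences_meeting:
  assumes "finite S" and xD: "i \<in> pixels n \<times> S"
  shows "card {j \<in> pixels n \<times> S. occurrence n r i \<inter> occurrence n r j \<noteq> {}}
    \<le> card S * (card (ref_ball r))\<^sup>2"
proof -
  obtain x D where i: "i = (x, D)" by (cases i)
  define T where "T = S \<times> ref_ball r \<times> ref_ball r"
  define f where "f = (\<lambda>(D', y, y'). (wrap n (x + y - y'), D' :: int \<times> int \<Rightarrow> bool))"
  have finT: "finite T" using assms finite_ref_ball by (simp add: T_def)
  have "{j \<in> pixels n \<times> S. occurrence n r i \<inter> occurrence n r j \<noteq> {}} \<subseteq> f ` T"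
  proof clarify
    fix x' D' assume D': "x' \<in> pixels n" "D' \<in> S"
      and "occurrence n r i \<inter> occurrence n r (x', D') \<noteq> {}"
    then obtain z where "z \<in> shift n x ` black r D" "z \<in> shift n x' ` black r D'"
      unfolding occurrence_def i by auto
    then obtain y y' where y: "y \<in> black r D" "y' \<in> black r D'" "shift n x y = shift n x' y'"
      by (elim imageE) simp
    have "wrap n x' = wrap n (x + y - y')"
      using y(3) unfolding shift_def wrap_eq_iff by (simp add: algebra_simps dvd_diff_commute)
    then have "(x', D') = f (D', y, y')" using wrap_pixel D' by (simp add: f_def)
    then show "(x', D') \<in> f ` T"
      using y black_subset D' by (intro image_eqI[of _ _ "(D', y, y')"]) (auto simp: T_def)
  qed
  then have "card {j \<in> pixels n \<times> S. occurrence n r i \<inter> occurrence n r j \<noteq> {}} \<le> card (f ` T)"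
    using finT by (intro card_mono) auto
  also have "\<dots> \<le> card T" using finT by (rule card_image_le)
  finally show ?thesis
    by (simp add: T_def card_cartesian_product power2_eq_square)
qed

text \<open>A dependent pair contributes at most \<open>p ^ (b+1)\<close> through \<open>P(A\<^sub>i \<inter> A\<^sub>j)\<close>, as different sets of size \<open>b\<close>
  have a larger union, and \<open>p ^ (2b)\<close> through \<open>P(A\<^sub>i) P(A\<^sub>j)\<close>, which is no more because \<open>b > 0\<close>.\<close>

lemma prob_some_occurrence:
  assumes S: "meaningful_set r \<psi> S" "finite S" and b: "black_index r \<psi> > 0"
    and n: "n > 4 * r" and p: "0 \<le> p" "p \<le> 1"
  defines "b \<equiv> black_index r \<psi>"
  shows "\<bar>measure_pmf.prob (image_pmf n p) (\<Union>i\<in>pixels n \<times> S. all_black (occurrence n r i))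
      - (1 - (1 - p ^ b) ^ (n\<^sup>2 * card S))\<bar>
    \<le> 2 * card S * (card S * (card (ref_ball r))\<^sup>2) * (real (n\<^sup>2) * p ^ Suc b)"
proof -
  define P where "P = measure_pmf.prob (image_pmf n p)"
  define J where "J = pixels n \<times> S"
  define F where "F = occurrence n r"
  define A where "A i = all_black (F i)" for i
  define K where "K = card S * (card (ref_ball r))\<^sup>2"
  have n0: "n > 0" using n by simp
  have Fpix: "F i \<subseteq> pixels n" for i
    using n0 by (auto simp: F_def occurrence_def shift_in_pixels split: prod.splits)
  have finF: "finite (F i)" for i using Fpix finite_subset finite_pixels by blast
  have cardF: "card (F i) = b" if "i \<in> J" for i
    using that S(1) card_shift[OF n black_subset]
    by (auto simp: F_def occurrence_def J_def b_def meaningful_set_def)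
  have PA: "P (A i) = p ^ b" if "i \<in> J" for i
    unfolding P_def A_def using prob_all_black[OF Fpix p] cardF[OF that] by simp
  have PAA: "P (A i \<inter> A j) \<le> p ^ Suc b" if "i \<in> J" "j \<in> J" "j \<noteq> i" for i j
  proof -
    have "F i \<noteq> F j"
      using inj_on_occurrence[OF S(1) b n] that unfolding J_def F_def inj_on_def by blast
    moreover have "F j = F i" if "F j \<subseteq> F i"
      using card_subset_eq[OF finF that] cardF \<open>i \<in> J\<close> \<open>j \<in> J\<close> by simp
    ultimately have "F i \<subset> F i \<union> F j" by blast
    then have "Suc b \<le> card (F i \<union> F j)"
      using psubset_card_mono[of "F i \<union> F j" "F i"] finF cardF that by simp
    moreover have "P (A i \<inter> A j) = p ^ card (F i \<union> F j)"
      unfolding P_def A_def all_black_Int using Fpix p by (intro prob_all_black) auto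
    ultimately show ?thesis using p by (simp only: power_decreasing)
  qed
  have b2: "p ^ b * p ^ b \<le> p ^ Suc b"
    using p b unfolding power_add[symmetric] b_def by (intro power_decreasing) auto
  define dep where "dep i j \<longleftrightarrow> F i \<inter> F j \<noteq> {}" for i j
  have "\<bar>P (\<Union>(A ` J)) - (1 - (\<Prod>i\<in>J. 1 - P (A i)))\<bar>
    \<le> (\<Sum>i\<in>J. \<Sum>j\<in>{j\<in>J. j \<noteq> i \<and> dep i j}. P (A i \<inter> A j) + P (A i) * P (A j))"
    unfolding P_def
  proof (rule measure_pmf.prob_union_local_dependence)
    show "finite J" using S(2) by (simp add: J_def)
    show "measure_pmf.prob (image_pmf n p) (A i \<inter> \<Union>(A ` K'))
      = measure_pmf.prob (image_pmf n p) (A i) * measure_pmf.prob (image_pmf n p) (\<Union>(A ` K'))"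
      if "\<And>j. j \<in> K' \<Longrightarrow> \<not> dep i j" for i K'
      unfolding A_def by (rule all_black_indep_union[OF Fpix]) (use that in \<open>auto simp: dep_def\<close>)
  qed auto
  also have "(\<Prod>i\<in>J. 1 - P (A i)) = (1 - p ^ b) ^ (n\<^sup>2 * card S)"
    using PA by (simp add: J_def card_cartesian_product card_pixels)
  also have "(\<Sum>i\<in>J. \<Sum>j\<in>{j\<in>J. j \<noteq> i \<and> dep i j}. P (A i \<inter> A j) + P (A i) * P (A j))
      \<le> (\<Sum>i\<in>J. real K * (2 * p ^ Suc b))"
  proof (rule sum_mono)
    fix i assume i: "i \<in> J"
    have "(\<Sum>j\<in>{j\<in>J. j \<noteq> i \<and> dep i j}. P (A i \<inter> A j) + P (A i) * P (A j))
        \<le> (\<Sum>j\<in>{j\<in>J. j \<noteq> i \<and> dep i j}. 2 * p ^ Suc b)"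
    proof (rule sum_mono)
      fix j assume "j \<in> {j\<in>J. j \<noteq> i \<and> dep i j}"
      then show "P (A i \<inter> A j) + P (A i) * P (A j) \<le> 2 * p ^ Suc b"
        using PAA[OF i, of j] PA[OF i] PA[of j] b2 by auto
    qed
    also have "\<dots> = real (card {j\<in>J. j \<noteq> i \<and> dep i j}) * (2 * p ^ Suc b)" by simp
    also have "\<dots> \<le> real K * (2 * p ^ Suc b)"
    proof (rule mult_right_mono)
      have "card {j\<in>J. j \<noteq> i \<and> dep i j} \<le> card {j\<in>J. dep i j}"
        using S(2) by (intro card_mono) (auto simp: J_def)
      also have "\<dots> \<le> K"
        using card_occurrences_meeting[OF S(2), of i n r] i unfolding J_def K_def dep_def F_def .
      finally show "real (card {j\<in>J. j \<noteq> i \<and> dep i j}) \<le> real K" by simp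
    qed (use p in auto)
    finally show "(\<Sum>j\<in>{j\<in>J. j \<noteq> i \<and> dep i j}. P (A i \<inter> A j) + P (A i) * P (A j))
        \<le> real K * (2 * p ^ Suc b)" .
  qed
  also have "\<dots> = 2 * card S * K * (real (n\<^sup>2) * p ^ Suc b)"
    by (simp add: J_def card_cartesian_product card_pixels)
  finally show ?thesis by (simp add: P_def J_def A_def F_def K_def)
qed

section \<open>The local property up to crowded balls\<close>

text \<open>The event that some ball contains at least \<open>k\<close> black pixels, in the form to which the union
  bound applies.\<close>

definition crowded :: "nat \<Rightarrow> nat \<Rightarrow> nat \<Rightarrow> image set" where
  "crowded n r k =
    (\<Union>x\<in>pixels n. \<Union>U\<in>{U. U \<subseteq> shift n x ` ref_ball r \<and> card U = k}. all_black U)"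

lemma prob_crowded:
  assumes "n > 0" "0 \<le> p" "p \<le> 1"
  shows "measure_pmf.prob (image_pmf n p) (crowded n r k)
    \<le> 2 ^ card (ref_ball r) * (real (n\<^sup>2) * p ^ k)"
proof -
  define P where "P = measure_pmf.prob (image_pmf n p)"
  define W where "W x = {U. U \<subseteq> shift n x ` ref_ball r \<and> card U = k}" for x
  have fin: "finite (shift n x ` ref_ball r)" for x using finite_ref_ball by simp
  have finW: "finite (W x)" for x
    unfolding W_def by (rule finite_subset[OF _ finite_Pow_iff[THEN iffD2, OF fin[of x]]]) auto
  have cardW: "card (W x) \<le> 2 ^ card (ref_ball r)" for x
  proof -
    have "card (W x) \<le> card (Pow (shift n x ` ref_ball r))"
      unfolding W_def using fin by (intro card_mono) auto
    also have "\<dots> = 2 ^ card (shift n x ` ref_ball r)" using fin by (simp add: card_Pow)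
    also have "\<dots> \<le> 2 ^ card (ref_ball r)"
      using finite_ref_ball by (intro power_increasing card_image_le) auto
    finally show ?thesis .
  qed
  have "P (crowded n r k) \<le> (\<Sum>x\<in>pixels n. P (\<Union>U\<in>W x. all_black U))"
    unfolding P_def crowded_def W_def by (intro measure_pmf.finite_measure_subadditive_finite) auto
  also have "\<dots> \<le> (\<Sum>x\<in>pixels n. 2 ^ card (ref_ball r) * p ^ k)"
  proof (rule sum_mono)
    fix x assume "x \<in> pixels n"
    have "P (\<Union>U\<in>W x. all_black U) \<le> (\<Sum>U\<in>W x. P (all_black U))"
      unfolding P_def using finW by (intro measure_pmf.finite_measure_subadditive_finite) auto
    also have "\<dots> = (\<Sum>U\<in>W x. p ^ k)"
    proof (rule sum.cong[OF refl])
      fix U assume "U \<in> W x"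
      then have "U \<subseteq> shift n x ` ref_ball r" "card U = k" by (simp_all add: W_def)
      moreover from this(1) have "U \<subseteq> pixels n"
        using shift_in_pixels[OF assms(1)] by (elim subset_trans) (rule image_subsetI)
      ultimately show "P (all_black U) = p ^ k" unfolding P_def using prob_all_black assms by simp
    qed
    also have "\<dots> = real (card (W x)) * p ^ k" by simp
    also have "\<dots> \<le> real (2 ^ card (ref_ball r)) * p ^ k"
      using cardW[of x] assms(2) by (intro mult_right_mono of_nat_mono zero_le_power)
    also have "\<dots> = 2 ^ card (ref_ball r) * p ^ k" by simp
    finally show "P (\<Union>U\<in>W x. all_black U) \<le> 2 ^ card (ref_ball r) * p ^ k" .
  qed
  also have "\<dots> = 2 ^ card (ref_ball r) * (real (n\<^sup>2) * p ^ k)" by (simp add: card_pixels)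
  finally show ?thesis by (simp add: P_def)
qed

lemma mem_crowdedI:
  assumes "x \<in> pixels n" "V \<subseteq> shift n x ` ref_ball r" "card V \<ge> k" "\<And>v. v \<in> V \<Longrightarrow> I v"
  shows "I \<in> crowded n r k"
proof -
  obtain U where "U \<subseteq> V" "card U = k" using obtain_subset_with_card_n[OF assms(3)] by blast
  then show ?thesis using assms unfolding crowded_def all_black_def by blast
qed

text \<open>A pattern of more than \<open>b(\<psi>)\<close> black pixels makes its ball crowded, and a pattern of exactly
  \<open>b(\<psi>)\<close> black pixels is a translate of one in \<open>S\<close>, which is then black around a possibly different pixel.\<close>

lemma local_property_subset:
  assumes \<psi>: "local_assertion r \<psi>" and S: "meaningful_set r \<psi> S" and n: "n > 4 * r"
  shows "local_property n r \<psi> \<subseteq>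
    (\<Union>i\<in>pixels n \<times> S. all_black (occurrence n r i)) \<union> crowded n r (Suc (black_index r \<psi>))"
proof
  fix I assume "I \<in> local_property n r \<psi>"
  then obtain x D where x: "x \<in> pixels n" and D: "D \<in> \<psi>"
    and eq: "{y \<in> torus_ball n x r. I y} = shift n x ` black r D"
    by (auto simp: local_property_def assertion_at_def pattern_at_def)
  have I: "I z" if "z \<in> shift n x ` black r D" for z using that eq by blast
  have "finite \<psi>" using \<psi> finite_patterns finite_subset unfolding local_assertion_def by blast
  then have ge: "black_index r \<psi> \<le> card (black r D)"
    unfolding black_index_def using D by (intro Min_le) auto
  show "I \<in> (\<Union>i\<in>pixels n \<times> S. all_black (occurrence n r i)) \<union> crowded n r (Suc (black_index r \<psi>))"
  proof (cases "card (black r D) = black_index r \<psi>")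
    case True
    then obtain t D' where D': "D' \<in> S" "(+) t ` black r D = black r D'"
      using S D unfolding meaningful_set_def by blast
    have "shift n (wrap n (x - t)) (t + y) = shift n x y" for y
      unfolding shift_def wrap_wrap_add by (simp add: algebra_simps)
    then have "shift n (wrap n (x - t)) ` black r D' = shift n x ` black r D"
      unfolding D'(2)[symmetric] by (simp add: image_image)
    then have "I \<in> all_black (occurrence n r (wrap n (x - t), D'))"
      using I by (simp add: all_black_def occurrence_def)
    moreover have "wrap n (x - t) \<in> pixels n" using n by (intro wrap_in_pixels) simp
    ultimately show ?thesis using D'(1) by blast
  next
    case False
    then have "Suc (black_index r \<psi>) \<le> card (shift n x ` black r D)"
      using ge card_shift[OF n black_subset] by simp
    then have "I \<in> crowded n r (Suc (black_index r \<psi>))"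
      by (rule mem_crowdedI[OF x image_mono[OF black_subset]]) (rule I)
    then show ?thesis by (rule UnI2)
  qed
qed

text \<open>If all pixels of the translated pattern are black, the pattern itself can only fail to occur
  because of a further black pixel in the ball.\<close>

lemma occurrence_subset_local_property:
  assumes S: "meaningful_set r \<psi> S" and n: "n > 4 * r"
  shows "(\<Union>i\<in>pixels n \<times> S. all_black (occurrence n r i))
    \<subseteq> local_property n r \<psi> \<union> crowded n r (Suc (black_index r \<psi>))"
proof clarify
  fix I x D
  assume x: "x \<in> pixels n" and D: "D \<in> S" and all: "I \<in> all_black (occurrence n r (x, D))"
    and nc: "I \<notin> crowded n r (Suc (black_index r \<psi>))"
  have I: "I z" if "z \<in> shift n x ` black r D" for z
    using all that unfolding all_black_def occurrence_def mem_Collect_eq prod.case by (rule bspec)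
  let ?V = "{y \<in> torus_ball n x r. I y}"
  have sub: "shift n x ` black r D \<subseteq> ?V"
    using I image_mono[OF black_subset, of "shift n x"] unfolding torus_ball_eq_shift[OF x] by blast
  have V: "?V \<subseteq> shift n x ` ref_ball r" using torus_ball_eq_shift[OF x] by blast
  have finV: "finite ?V" using V finite_ref_ball finite_subset by blast
  have c: "card (shift n x ` black r D) = black_index r \<psi>"
    using S D card_shift[OF n black_subset] unfolding meaningful_set_def by simp
  have "\<not> Suc (black_index r \<psi>) \<le> card ?V"
    using mem_crowdedI[OF x V, of _ I] nc by blast
  then have "shift n x ` black r D = ?V"
    using sub c card_mono[OF finV sub] by (intro card_subset_eq[OF finV]) auto
  moreover have "D \<in> \<psi>" using S D unfolding meaningful_set_def by blast
  ultimately show "I \<in> local_property n r \<psi>"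
    using x unfolding local_property_def assertion_at_def pattern_at_def by blast
qed

lemma prob_diff_le_of_subset_Un:
  assumes "X \<subseteq> Y \<union> Z" "Y \<subseteq> X \<union> Z"
  shows "\<bar>measure_pmf.prob M X - measure_pmf.prob M Y\<bar> \<le> measure_pmf.prob M Z"
proof -
  have "measure_pmf.prob M A \<le> measure_pmf.prob M B + measure_pmf.prob M Z" if "A \<subseteq> B \<union> Z" for A B
    using measure_pmf.finite_measure_mono[OF that, of M] measure_Un_le[of B "measure_pmf M" Z] by simp
  from this[OF assms(1)] this[OF assms(2)] show ?thesis by linarith
qed

lemma prob_local_property:
  assumes \<psi>: "local_assertion r \<psi>" and b0: "black_index r \<psi> > 0"
  obtains C where "\<And>n p. n > 4 * r \<Longrightarrow> 0 \<le> p \<Longrightarrow> p \<le> 1 \<Longrightarrow>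
    \<bar>measure_pmf.prob (image_pmf n p) (local_property n r \<psi>)
      - (1 - (1 - p ^ black_index r \<psi>) ^ (n\<^sup>2 * meaningful_index r \<psi>))\<bar>
    \<le> C * (real (n\<^sup>2) * p ^ Suc (black_index r \<psi>))"
proof -
  obtain S where S: "meaningful_set r \<psi> S" using meaningful_set_exists by blast
  have "S \<subseteq> \<psi>" "\<psi> \<subseteq> patterns r"
    using S \<psi> by (simp_all add: meaningful_set_def local_assertion_def)
  then have finS: "finite S" by (rule finite_subset[OF subset_trans finite_patterns])
  have e: "meaningful_index r \<psi> = card S" by (rule meaningful_index_eq[OF \<psi> S])
  define C1 where "C1 = 2 * real (card S) * (card S * (card (ref_ball r))\<^sup>2)"
  define C2 :: real where "C2 = 2 ^ card (ref_ball r)"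
  show ?thesis
  proof (rule that[of "C1 + C2"])
    fix n p assume n: "n > 4 * r" and p: "0 \<le> p" "p \<le> (1::real)"
    let ?E = "\<Union>i\<in>pixels n \<times> S. all_black (occurrence n r i)"
    let ?H = "crowded n r (Suc (black_index r \<psi>))"
    let ?P = "measure_pmf.prob (image_pmf n p)"
    have "\<bar>?P (local_property n r \<psi>) - ?P ?E\<bar> \<le> ?P ?H"
      by (rule prob_diff_le_of_subset_Un
          [OF local_property_subset[OF \<psi> S n] occurrence_subset_local_property[OF S n]])
    moreover have "?P ?H \<le> C2 * (real (n\<^sup>2) * p ^ Suc (black_index r \<psi>))"
      unfolding C2_def using n p by (intro prob_crowded) auto
    moreover have "\<bar>?P ?E - (1 - (1 - p ^ black_index r \<psi>) ^ (n\<^sup>2 * card S))\<bar>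
        \<le> C1 * (real (n\<^sup>2) * p ^ Suc (black_index r \<psi>))"
      unfolding C1_def using prob_some_occurrence[OF S finS b0 n p] by simp
    ultimately show "\<bar>?P (local_property n r \<psi>)
        - (1 - (1 - p ^ black_index r \<psi>) ^ (n\<^sup>2 * meaningful_index r \<psi>))\<bar>
      \<le> (C1 + C2) * (real (n\<^sup>2) * p ^ Suc (black_index r \<psi>))"
      unfolding e distrib_right by linarith
  qed
qed

section \<open>The threshold limit\<close>

theorem theorem2p4:
  fixes r :: nat and \<psi> :: "(int \<times> int \<Rightarrow> bool) set" and c :: real
  assumes "local_assertion r \<psi>"
    and "black_index r \<psi> > 0"
    and "c > 0"
  shows "(\<lambda>n. measure_pmf.prob
             (image_pmf n (c * real n powr (- 2 / real (black_index r \<psi>))))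
             (local_property n r \<psi>))
           \<longlonglongrightarrow> 1 - exp (- real (meaningful_index r \<psi>) * c ^ black_index r \<psi>)"
proof -
  define b where "b = black_index r \<psi>"
  define e where "e = meaningful_index r \<psi>"
  define p where "p n = c * real n powr (- 2 / real b)" for n
  define P where "P n = measure_pmf.prob (image_pmf n (p n)) (local_property n r \<psi>)" for n
  have b: "b > 0" using assms(2) by (simp add: b_def)
  obtain C where C: "\<And>n p. n > 4 * r \<Longrightarrow> 0 \<le> p \<Longrightarrow> p \<le> 1 \<Longrightarrow>
    \<bar>measure_pmf.prob (image_pmf n p) (local_property n r \<psi>) - (1 - (1 - p ^ b) ^ (n\<^sup>2 * e))\<bar>
    \<le> C * (real (n\<^sup>2) * p ^ Suc b)"
    using prob_local_property[OF assms(1,2)] unfolding b_def e_def by metis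
  have pb: "p n ^ b = c ^ b / real (n\<^sup>2)" if "n > 0" for n
  proof -
    have "(real n powr (- 2 / real b)) ^ b = real n powr (- 2)"
      using b that by (simp add: powr_powr flip: powr_realpow)
    also have "\<dots> = 1 / real (n\<^sup>2)"
      using that by (simp add: powr_minus_divide)
    finally show ?thesis
      unfolding p_def power_mult_distrib by simp
  qed
  have "(\<lambda>n. real n powr (- 2 / real b)) \<longlonglongrightarrow> 0"
    using b by (intro tendsto_neg_powr filterlim_real_sequentially) auto
  then have p0: "p \<longlonglongrightarrow> 0"
    unfolding p_def using tendsto_mult_right_zero by blast
  have p_nonneg: "p n \<ge> 0" for n using assms(3) by (simp add: p_def)
  have p_le: "eventually (\<lambda>n. p n \<le> 1) sequentially"
    using order_tendstoD(2)[OF p0, of 1] by (auto elim: eventually_mono)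
  have "(\<lambda>n. (1 + (- (c ^ b)) / real (n\<^sup>2)) ^ n\<^sup>2) \<longlonglongrightarrow> exp (- (c ^ b))"
    by (rule filterlim_compose[OF tendsto_exp_limit_sequentially])
      (auto intro!: filterlim_at_top_mono[OF filterlim_ident] simp: power2_eq_square)
  then have "(\<lambda>n. ((1 + (- (c ^ b)) / real (n\<^sup>2)) ^ n\<^sup>2) ^ e) \<longlonglongrightarrow> exp (- (c ^ b)) ^ e"
    by (rule tendsto_power)
  also have "exp (- (c ^ b)) ^ e = exp (- real e * c ^ b)"
    by (simp flip: exp_of_nat_mult)
  finally have "(\<lambda>n. (1 - p n ^ b) ^ (n\<^sup>2 * e)) \<longlonglongrightarrow> exp (- real e * c ^ b)"
  proof (rule Lim_transform_eventually)
    show "eventually (\<lambda>n. ((1 + (- (c ^ b)) / real (n\<^sup>2)) ^ n\<^sup>2) ^ e = (1 - p n ^ b) ^ (n\<^sup>2 * e))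
        sequentially"
      using eventually_gt_at_top[of 0] by eventually_elim (simp add: pb power_mult)
  qed
  then have main: "(\<lambda>n. 1 - (1 - p n ^ b) ^ (n\<^sup>2 * e)) \<longlonglongrightarrow> 1 - exp (- real e * c ^ b)"
    by (intro tendsto_diff tendsto_const)
  have "(\<lambda>n. P n - (1 - (1 - p n ^ b) ^ (n\<^sup>2 * e))) \<longlonglongrightarrow> 0"
  proof (rule Lim_null_comparison)
    show "eventually (\<lambda>n. norm (P n - (1 - (1 - p n ^ b) ^ (n\<^sup>2 * e))) \<le> C * c ^ b * p n) sequentially"
      using p_le eventually_gt_at_top[of "4 * r"]
    proof eventually_elim
      case (elim n)
      have "real (n\<^sup>2) * p n ^ Suc b = c ^ b * p n" using elim(2) pb[of n] by simp
      with C[OF elim(2) p_nonneg elim(1)] show ?case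
        unfolding P_def real_norm_def by (simp only: mult.assoc)
    qed
    show "(\<lambda>n. C * c ^ b * p n) \<longlonglongrightarrow> 0"
      using p0 by (rule tendsto_mult_right_zero)
  qed
  from tendsto_add[OF this main] show ?thesis
    by (simp add: P_def p_def b_def e_def)
qed

end
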